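(* Consider an instance of the Adwords problem, with finite set of bidders $U$, budgets $B_u>0$, finite set of online vertices $V$ arriving one at a time in an arbitrary (adversarial) order, and bids $w_{uv}\ge 0$. Suppose the small-bids assumption holds for the run of the Greedy algorithm on this instance. Then the Greedy algorithm achieves a ratio of $\frac12$: the total revenue it obtains is at least $\frac12\,\mathrm{OPT}$, where $\mathrm{OPT}$ is the optimal value of the offline Adwords linear program.
   Context: Offline Adwords linear program: maximize $\sum_{u,v} x_{uv}w_{uv}$ subject to $\sum_v x_{uv}w_{uv}\le B_u$ for all $u\in U$, $\sum_u x_{uv}\le 1$ for all $v\in V$, and $x_{uv}\ge 0$. Its optimal value is $\mathrm{OPT}$. Online problem: the vertices $v\in V$ arrive one at a time. When $v$ arrives, its bids $(w_{uv})_{u\in U}$ are revealed, and $v$ must be irrevocably matched to at most one bidder $u$. Matching $v$ to $u$ earns revenue $\min(w_{uv},RB_u)$, where $RB_u$ is the remaining budget of $u$ ($B_u$ minus the amount spent by $u$ so far). A neighbor of $v$ is a bidder $u$ with $w_{uv}>0$. A bidder is available if its remaining budget is positive. Greedy algorithm: when $v$ arrives, if $v$ has no available neighbor, leave it unmatched. Otherwise match it to an available neighbor $u$ maximizing the bid $\min(w_{uv},RB_u)$, with ties broken arbitrarily. Small-bids assumption: whenever a vertex $v$ arrives and $u$ is an available neighbor of $v$, one has $w_{uv}\le RB_u$, so that $\min(w_{uv},RB_u)=w_{uv}$. *)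

theory Defs
  imports Complex_Main
begin

section \<open>The offline linear program\<close>

definition adwords_feasible ::
  "'u set \<Rightarrow> 'v set \<Rightarrow> ('u \<Rightarrow> real) \<Rightarrow> ('u \<Rightarrow> 'v \<Rightarrow> real) \<Rightarrow> ('u \<Rightarrow> 'v \<Rightarrow> real) \<Rightarrow> bool" where
  "adwords_feasible U V B w x \<longleftrightarrow>
     (\<forall>u\<in>U. (\<Sum>v\<in>V. x u v * w u v) \<le> B u) \<and>
     (\<forall>v\<in>V. (\<Sum>u\<in>U. x u v) \<le> 1) \<and>
     (\<forall>u\<in>U. \<forall>v\<in>V. 0 \<le> x u v)"

definition adwords_value ::
  "'u set \<Rightarrow> 'v set \<Rightarrow> ('u \<Rightarrow> 'v \<Rightarrow> real) \<Rightarrow> ('u \<Rightarrow> 'v \<Rightarrow> real) \<Rightarrow> real" where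
  "adwords_value U V w x = (\<Sum>u\<in>U. \<Sum>v\<in>V. x u v * w u v)"

definition adwords_OPT ::
  "'u set \<Rightarrow> 'v set \<Rightarrow> ('u \<Rightarrow> real) \<Rightarrow> ('u \<Rightarrow> 'v \<Rightarrow> real) \<Rightarrow> real" where
  "adwords_OPT U V B w = Sup {adwords_value U V w x | x. adwords_feasible U V B w x}"

text \<open>
  The supremum above is taken in the reals; the next two lemmas show that it is a genuine
  least upper bound whenever the budgets are nonnegative.
\<close>

lemma adwords_values_nonempty:
  assumes "\<And>u. u \<in> U \<Longrightarrow> 0 \<le> B u"
  shows "{adwords_value U V w x | x. adwords_feasible U V B w x} \<noteq> {}"
proof -
  have "adwords_feasible U V B w (\<lambda>_ _. 0)"
    using assms by (simp add: adwords_feasible_def)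
  then show ?thesis by blast
qed

lemma adwords_values_bdd_above:
  "bdd_above {adwords_value U V w x | x. adwords_feasible U V B w x}"
proof (rule bdd_aboveI)
  fix r assume "r \<in> {adwords_value U V w x | x. adwords_feasible U V B w x}"
  then show "r \<le> (\<Sum>u\<in>U. B u)"
    by (auto simp: adwords_value_def adwords_feasible_def intro!: sum_mono)
qed

section \<open>The online process\<close>

text \<open>
  \<open>R\<close> is the current vector of remaining budgets. A matching is a map \<open>M\<close> sending each arriving
  vertex to the bidder it is matched to (\<open>None\<close> if it is left unmatched), and the list \<open>vs\<close>
  gives the order of arrival.
\<close>

definition bid :: "('u \<Rightarrow> 'v \<Rightarrow> real) \<Rightarrow> ('u \<Rightarrow> real) \<Rightarrow> 'u \<Rightarrow> 'v \<Rightarrow> real" where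
  "bid w R u v = min (w u v) (R u)"

definition available_neighbors ::
  "'u set \<Rightarrow> ('u \<Rightarrow> 'v \<Rightarrow> real) \<Rightarrow> ('u \<Rightarrow> real) \<Rightarrow> 'v \<Rightarrow> 'u set" where
  "available_neighbors U w R v = {u \<in> U. 0 < w u v \<and> 0 < R u}"

definition pay ::
  "('u \<Rightarrow> 'v \<Rightarrow> real) \<Rightarrow> 'v \<Rightarrow> 'u option \<Rightarrow> ('u \<Rightarrow> real) \<Rightarrow> ('u \<Rightarrow> real)" where
  "pay w v c R = (case c of None \<Rightarrow> R | Some u \<Rightarrow> R(u := R u - bid w R u v))"

definition remaining_budget ::
  "('u \<Rightarrow> real) \<Rightarrow> ('u \<Rightarrow> 'v \<Rightarrow> real) \<Rightarrow> ('v \<Rightarrow> 'u option) \<Rightarrow> 'v list \<Rightarrow> 'u \<Rightarrow> real" where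
  "remaining_budget B w M vs = fold (\<lambda>v. pay w v (M v)) vs B"

definition total_revenue ::
  "('u \<Rightarrow> real) \<Rightarrow> ('u \<Rightarrow> 'v \<Rightarrow> real) \<Rightarrow> ('v \<Rightarrow> 'u option) \<Rightarrow> 'v list \<Rightarrow> real" where
  "total_revenue B w M vs =
     (\<Sum>i<length vs. case M (vs ! i) of
        None \<Rightarrow> 0
      | Some u \<Rightarrow> bid w (remaining_budget B w M (take i vs)) u (vs ! i))"

section \<open>The Greedy algorithm\<close>

text \<open>
  Greedy is a relation rather than a function: \<open>greedy_choice\<close> admits every way of breaking ties,
  so \<open>greedy_run\<close> holds of exactly the matchings that Greedy may produce.
\<close>

definition greedy_choice ::
  "'u set \<Rightarrow> ('u \<Rightarrow> 'v \<Rightarrow> real) \<Rightarrow> ('u \<Rightarrow> real) \<Rightarrow> 'v \<Rightarrow> 'u option \<Rightarrow> bool" where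
  "greedy_choice U w R v c =
     (case c of
        None \<Rightarrow> available_neighbors U w R v = {}
      | Some u \<Rightarrow> u \<in> available_neighbors U w R v \<and>
          (\<forall>u'\<in>available_neighbors U w R v. bid w R u' v \<le> bid w R u v))"

definition greedy_run ::
  "'u set \<Rightarrow> ('u \<Rightarrow> real) \<Rightarrow> ('u \<Rightarrow> 'v \<Rightarrow> real) \<Rightarrow> 'v list \<Rightarrow> ('v \<Rightarrow> 'u option) \<Rightarrow> bool" where
  "greedy_run U B w vs M \<longleftrightarrow>
     (\<forall>i<length vs.
        greedy_choice U w (remaining_budget B w M (take i vs)) (vs ! i) (M (vs ! i)))"

definition small_bids ::
  "'u set \<Rightarrow> ('u \<Rightarrow> real) \<Rightarrow> ('u \<Rightarrow> 'v \<Rightarrow> real) \<Rightarrow> 'v list \<Rightarrow> ('v \<Rightarrow> 'u option) \<Rightarrow> bool" where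
  "small_bids U B w vs M \<longleftrightarrow>
     (\<forall>i<length vs.
        \<forall>u\<in>available_neighbors U w (remaining_budget B w M (take i vs)) (vs ! i).
          w u (vs ! i) \<le> remaining_budget B w M (take i vs) u)"

end

theory Submission
  imports Defs
begin

text \<open>
  The proof is by linear programming duality. The dual of the offline program asks for prices
  \<open>y u \<ge> 0\<close> per unit of budget and utilities \<open>z v \<ge> 0\<close> with \<open>w u v \<le> w u v * y u + z v\<close>, and
  minimizes \<open>(\<Sum>u\<in>U. B u * y u) + (\<Sum>v\<in>V. z v)\<close>. A run of Greedy supplies such a pair: let \<open>y u\<close>
  be 1 if the budget of \<open>u\<close> is exhausted at the end of the run and 0 otherwise, and let \<open>z v\<close> be
  the revenue collected when \<open>v\<close> arrives.

  This pair is dual feasible. If \<open>u\<close> is exhausted, its price alone covers the bid. If it is not,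
  then it had budget left when a neighbor \<open>v\<close> arrived, as budgets only shrink; Greedy could choose
  \<open>u\<close>, so it collected at least the effective bid of \<open>u\<close>, which equals \<open>w u v\<close> by the
  small-bids assumption (\<open>greedy_earns_bid_of_unexhausted\<close>).

  Both parts of the dual objective are at most the revenue of Greedy. For the utilities this is
  an equality. For the prices, the budget of an exhausted bidder has been spent completely, and
  all that is spent is revenue (\<open>total_revenue_eq_spent\<close>). Hence weak duality
  (\<open>adwords_weak_duality\<close>) bounds the optimum by twice the revenue.
\<close>

section \<open>Weak duality\<close>

text \<open>
  Multiplying the dual constraint of each edge by \<open>x u v\<close> and summing, the primal constraints of
  the bidders and of the vertices bound the two resulting sums.
\<close>

lemma adwords_weak_duality:
  assumes feasible: "adwords_feasible U V B w x"
    and y: "\<And>u. u \<in> U \<Longrightarrow> 0 \<le> y u"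
    and z: "\<And>v. v \<in> V \<Longrightarrow> 0 \<le> z v"
    and dual: "\<And>u v. u \<in> U \<Longrightarrow> v \<in> V \<Longrightarrow> w u v \<le> w u v * y u + z v"
  shows "adwords_value U V w x \<le> (\<Sum>u\<in>U. B u * y u) + (\<Sum>v\<in>V. z v)"
proof -
  have x: "\<And>u v. u \<in> U \<Longrightarrow> v \<in> V \<Longrightarrow> 0 \<le> x u v"
    and budget: "\<And>u. u \<in> U \<Longrightarrow> (\<Sum>v\<in>V. x u v * w u v) \<le> B u"
    and vertex: "\<And>v. v \<in> V \<Longrightarrow> (\<Sum>u\<in>U. x u v) \<le> 1"
    using feasible by (auto simp: adwords_feasible_def)
  have "adwords_value U V w x \<le> (\<Sum>u\<in>U. \<Sum>v\<in>V. x u v * (w u v * y u + z v))"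
    unfolding adwords_value_def by (intro sum_mono mult_left_mono dual x)
  also have "\<dots> = (\<Sum>u\<in>U. \<Sum>v\<in>V. x u v * w u v * y u) + (\<Sum>u\<in>U. \<Sum>v\<in>V. x u v * z v)"
    by (simp add: distrib_left sum.distrib mult.assoc)
  also have "(\<Sum>u\<in>U. \<Sum>v\<in>V. x u v * z v) = (\<Sum>v\<in>V. \<Sum>u\<in>U. x u v * z v)"
    by (rule sum.swap)
  also have "(\<Sum>u\<in>U. \<Sum>v\<in>V. x u v * w u v * y u) + (\<Sum>v\<in>V. \<Sum>u\<in>U. x u v * z v)
      = (\<Sum>u\<in>U. (\<Sum>v\<in>V. x u v * w u v) * y u) + (\<Sum>v\<in>V. (\<Sum>u\<in>U. x u v) * z v)"
    by (simp add: sum_distrib_right)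
  also have "\<dots> \<le> (\<Sum>u\<in>U. B u * y u) + (\<Sum>v\<in>V. 1 * z v)"
    by (intro add_mono sum_mono mult_right_mono budget vertex y z)
  finally show ?thesis by simp
qed

section \<open>Accounting for a run\<close>

definition earned ::
  "('u \<Rightarrow> 'v \<Rightarrow> real) \<Rightarrow> ('u \<Rightarrow> real) \<Rightarrow> 'v \<Rightarrow> 'u option \<Rightarrow> real" where
  "earned w R v c = (case c of None \<Rightarrow> 0 | Some u \<Rightarrow> bid w R u v)"

lemma total_revenue_eq_sum_earned:
  "total_revenue B w M vs =
     (\<Sum>i<length vs. earned w (remaining_budget B w M (take i vs)) (vs ! i) (M (vs ! i)))"
  by (simp add: total_revenue_def earned_def)

lemma remaining_budget_take_Suc:
  assumes "i < length vs"
  shows "remaining_budget B w M (take (Suc i) vs) =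
    pay w (vs ! i) (M (vs ! i)) (remaining_budget B w M (take i vs))"
  using assms by (simp add: remaining_budget_def take_Suc_conv_app_nth)

lemma sum_pay:
  assumes "finite U" and "\<And>u. c = Some u \<Longrightarrow> u \<in> U"
  shows "(\<Sum>u\<in>U. pay w v c R u) = (\<Sum>u\<in>U. R u) - earned w R v c"
proof (cases c)
  case None
  then show ?thesis by (simp add: pay_def earned_def)
next
  case (Some u)
  then have "u \<in> U" using assms by simp
  then show ?thesis
    using Some \<open>finite U\<close> by (simp add: pay_def earned_def sum.remove[of U u])
qed

lemma total_revenue_eq_spent:
  assumes "finite U" and matched: "\<And>v u. v \<in> set vs \<Longrightarrow> M v = Some u \<Longrightarrow> u \<in> U"
  shows "total_revenue B w M vs = (\<Sum>u\<in>U. B u - remaining_budget B w M vs u)"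
proof -
  let ?R = "\<lambda>i. remaining_budget B w M (take i vs)"
  have "(\<Sum>i<n. earned w (?R i) (vs ! i) (M (vs ! i))) = (\<Sum>u\<in>U. B u - ?R n u)"
    if "n \<le> length vs" for n
    using that
  proof (induction n)
    case 0
    show ?case by (simp add: remaining_budget_def)
  next
    case (Suc n)
    then have "(\<Sum>u\<in>U. ?R (Suc n) u) =
        (\<Sum>u\<in>U. ?R n u) - earned w (?R n) (vs ! n) (M (vs ! n))"
      using matched[of "vs ! n"]
      by (simp add: remaining_budget_take_Suc sum_pay[OF \<open>finite U\<close>])
    with Suc show ?case by (simp add: sum_subtractf)
  qed
  from this[of "length vs"] show ?thesis by (simp add: total_revenue_eq_sum_earned)
qed

section \<open>Greedy steps and runs\<close>

lemma greedy_choice_bid_nonneg: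
  assumes "greedy_choice U w R v (Some u)"
  shows "0 \<le> bid w R u v"
  using assms by (simp add: greedy_choice_def available_neighbors_def bid_def)

lemma greedy_choice_earned_nonneg:
  assumes "greedy_choice U w R v c"
  shows "0 \<le> earned w R v c"
  using assms by (cases c) (auto simp: earned_def intro: greedy_choice_bid_nonneg)

lemma greedy_choice_pay_le:
  assumes "greedy_choice U w R v c"
  shows "pay w v c R u \<le> R u"
  using assms by (cases c) (auto simp: pay_def dest: greedy_choice_bid_nonneg)

lemma greedy_choice_bid_le_earned:
  assumes "greedy_choice U w R v c" and "u \<in> available_neighbors U w R v"
  shows "bid w R u v \<le> earned w R v c"
  using assms by (cases c) (auto simp: greedy_choice_def earned_def)

lemma greedy_run_remaining_budget_antimono:
  assumes "greedy_run U B w vs M" and "i \<le> j" and "j \<le> length vs"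
  shows "remaining_budget B w M (take j vs) u \<le> remaining_budget B w M (take i vs) u"
  using \<open>i \<le> j\<close> \<open>j \<le> length vs\<close>
proof (induction j rule: dec_induct)
  case (step n)
  then have n: "n < length vs" by simp
  have "greedy_choice U w (remaining_budget B w M (take n vs)) (vs ! n) (M (vs ! n))"
    using assms(1) n by (simp add: greedy_run_def)
  then have "remaining_budget B w M (take (Suc n) vs) u \<le> remaining_budget B w M (take n vs) u"
    unfolding remaining_budget_take_Suc[OF n] by (rule greedy_choice_pay_le)
  with step show ?case by simp
qed simp

text \<open>
  A bidder with budget left at the end was available at every earlier arrival of one of its
  neighbors, hence Greedy never earned less than its bid. This is the dual constraint of the
  bidders that have price 0.
\<close>

lemma greedy_earns_bid_of_unexhausted:
  assumes greedy: "greedy_run U B w vs M" and small: "small_bids U B w vs M"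
    and "u \<in> U" and left: "0 < remaining_budget B w M vs u" and i: "i < length vs"
  shows "w u (vs ! i) \<le>
    earned w (remaining_budget B w M (take i vs)) (vs ! i) (M (vs ! i))"
proof -
  let ?R = "remaining_budget B w M (take i vs)" and ?v = "vs ! i"
  have choice: "greedy_choice U w ?R ?v (M ?v)"
    using greedy i by (simp add: greedy_run_def)
  have "0 < ?R u"
    using greedy_run_remaining_budget_antimono[OF greedy, of i "length vs" u] left i by simp
  show ?thesis
  proof (cases "0 < w u ?v")
    case True
    then have avail: "u \<in> available_neighbors U w ?R ?v"
      using \<open>u \<in> U\<close> \<open>0 < ?R u\<close> by (simp add: available_neighbors_def)
    then have "w u ?v \<le> ?R u"
      using small i by (simp add: small_bids_def)
    then have "w u ?v = bid w ?R u ?v" by (simp add: bid_def)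
    also have "\<dots> \<le> earned w ?R ?v (M ?v)"
      using choice avail by (rule greedy_choice_bid_le_earned)
    finally show ?thesis .
  next
    case False
    with greedy_choice_earned_nonneg[OF choice] show ?thesis by simp
  qed
qed

section \<open>The competitive ratio\<close>

theorem theorem1:
  fixes U :: "'u set" and V :: "'v set"
    and B :: "'u \<Rightarrow> real" and w :: "'u \<Rightarrow> 'v \<Rightarrow> real"
    and vs :: "'v list" and M :: "'v \<Rightarrow> 'u option"
  assumes "finite U" and "finite V"
    and "\<And>u. u \<in> U \<Longrightarrow> 0 < B u"
    and "\<And>u v. u \<in> U \<Longrightarrow> v \<in> V \<Longrightarrow> 0 \<le> w u v"
    and "distinct vs" and "set vs = V"
    and "greedy_run U B w vs M"
    and "small_bids U B w vs M"
  shows "total_revenue B w M vs \<ge> 1 / 2 * adwords_OPT U V B w"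
proof -
  let ?R = "\<lambda>i. remaining_budget B w M (take i vs)"
  let ?ALG = "total_revenue B w M vs"
  define gain where "gain i = earned w (?R i) (vs ! i) (M (vs ! i))" for i
  define y :: "'u \<Rightarrow> real" where
    "y u = (if 0 < remaining_budget B w M vs u then 0 else 1)" for u
  \<comment> \<open>Dual utilities belong to vertices, gains to arrival times; arrivals are distinct.\<close>
  define z where "z v = gain (the_inv_into {..<length vs} ((!) vs) v)" for v
  have index: "bij_betw ((!) vs) {..<length vs} V"
    using \<open>distinct vs\<close> \<open>set vs = V\<close> by (simp add: bij_betw_nth)
  have z_nth: "z (vs ! i) = gain i" if "i < length vs" for i
    using that index by (simp add: z_def bij_betw_def the_inv_into_f_f)
  have choice: "greedy_choice U w (?R i) (vs ! i) (M (vs ! i))" if "i < length vs" for i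
    using that \<open>greedy_run U B w vs M\<close> by (simp add: greedy_run_def)
  have z_nonneg: "0 \<le> z v" if "v \<in> V" for v
    using that \<open>set vs = V\<close> greedy_choice_earned_nonneg[OF choice]
    by (auto simp: in_set_conv_nth z_nth gain_def)
  have dual: "w u v \<le> w u v * y u + z v" if "u \<in> U" "v \<in> V" for u v
  proof (cases "0 < remaining_budget B w M vs u")
    case True
    obtain i where "i < length vs" "v = vs ! i"
      using \<open>v \<in> V\<close> \<open>set vs = V\<close> by (auto simp: in_set_conv_nth)
    then have "w u v \<le> z v"
      using greedy_earns_bid_of_unexhausted[OF assms(7,8) \<open>u \<in> U\<close> True] by (simp add: z_nth gain_def)
    with True show ?thesis by (simp add: y_def)
  next
    case False
    with z_nonneg[OF \<open>v \<in> V\<close>] show ?thesis by (simp add: y_def)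
  qed
  have utilities: "(\<Sum>v\<in>V. z v) = ?ALG"
    using sum.reindex_bij_betw[OF index, of z]
    by (simp add: total_revenue_eq_sum_earned gain_def[symmetric] z_nth)
  have "(\<Sum>u\<in>U. B u * y u) \<le> (\<Sum>u\<in>U. B u - remaining_budget B w M vs u)"
  proof (rule sum_mono)
    fix u
    have "remaining_budget B w M vs u \<le> B u"
      using greedy_run_remaining_budget_antimono[OF assms(7), of 0 "length vs" u]
      by (simp add: remaining_budget_def)
    then show "B u * y u \<le> B u - remaining_budget B w M vs u" by (simp add: y_def)
  qed
  also have "\<dots> = ?ALG"
  proof (rule total_revenue_eq_spent[symmetric, OF \<open>finite U\<close>])
    fix v u assume "v \<in> set vs" "M v = Some u"
    then obtain i where "i < length vs" "M (vs ! i) = Some u"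
      by (auto simp: in_set_conv_nth)
    then show "u \<in> U"
      using choice[of i] by (simp add: greedy_choice_def available_neighbors_def)
  qed
  finally have prices: "(\<Sum>u\<in>U. B u * y u) \<le> ?ALG" .
  have "adwords_OPT U V B w \<le> 2 * ?ALG"
    unfolding adwords_OPT_def
  proof (rule cSup_least)
    show "{adwords_value U V w x | x. adwords_feasible U V B w x} \<noteq> {}"
      using assms(3) by (intro adwords_values_nonempty less_imp_le)
    fix r assume "r \<in> {adwords_value U V w x | x. adwords_feasible U V B w x}"
    then obtain x where "r = adwords_value U V w x" and x: "adwords_feasible U V B w x"
      by blast
    moreover have "adwords_value U V w x \<le> (\<Sum>u\<in>U. B u * y u) + (\<Sum>v\<in>V. z v)"
      using x by (rule adwords_weak_duality) (simp_all add: y_def z_nonneg dual[unfolded y_def])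
    ultimately show "r \<le> 2 * ?ALG" using prices utilities by linarith
  qed
  then show ?thesis by simp
qed

end
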